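(* For every set of formulas $\Gamma\cup\{\varphi\}\subseteq \mathbf{F}(\Sigma_{\mathbf{nbI}},\mathcal V)$: if $\Gamma\vdash_{\mathbf{nbI}}\varphi$ then $\Gamma\Vdash^{\mathbf{nbI}}_{\mathcal F}\varphi$.
   Context: Let $\mathcal V$ be a countable set of propositional variables and $\Sigma_{\mathbf{nbI}}=\{\vee,\wedge,\rightarrow,\uparrow,\neg\}$ with $\neg$ unary and the other connectives binary; $\mathbf F(\Sigma_{\mathbf{nbI}},\mathcal V)$ is the set of formulas. The logic $\mathbf{nbI}$ is the Hilbert calculus whose only inference rule is Modus Ponens and whose axioms are all instances (with arbitrary formulas) of: (1) $\alpha\to(\beta\to\alpha)$; (2) $(\alpha\to(\beta\to\gamma))\to((\alpha\to\beta)\to(\alpha\to\gamma))$; (3) $\alpha\to(\beta\to(\alpha\wedge\beta))$; (4) $(\alpha\wedge\beta)\to\alpha$; (5) $(\alpha\wedge\beta)\to\beta$; (6) $\alpha\to(\alpha\vee\beta)$; (7) $\beta\to(\alpha\vee\beta)$; (8) $(\alpha\to\gamma)\to((\beta\to\gamma)\to((\alpha\vee\beta)\to\gamma))$; (9) $(\alpha\to\beta)\vee\alpha$; (Ip) $(\alpha\uparrow\beta)\to(\alpha\to(\beta\to\gamma))$; (Comm) $(\alpha\uparrow\beta)\to(\beta\uparrow\alpha)$; (11) $\alpha\vee\neg\alpha$. $\Gamma\vdash_{\mathbf{nbI}}\varphi$ means that there is a finite derivation of $\varphi$ from premises in $\Gamma$. A $\Sigma$-multialgebra on a nonempty set $A$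 interprets each $n$-ary connective $\sigma$ as a function $\sigma_{\mathcal A}:A^n\to\wp(A)\setminus\{\emptyset\}$; an operation with only singleton values is identified with an ordinary operation. A valuation over $\mathcal A$ is a map $\nu$ from formulas to $A$ with $\nu(\sigma(\varphi_1,\dots,\varphi_n))\in\sigma_{\mathcal A}(\nu(\varphi_1),\dots,\nu(\varphi_n))$ for all connectives $\sigma$ and formulas $\varphi_i$. An RNmatrix (restricted non-deterministic matrix) for $\mathbf{nbI}$ is a triple $(\mathcal A,D,\mathcal F)$ where: - $\mathcal A$ is a $\Sigma_{\mathbf{nbI}}$-multialgebra with universe $A$ in which $\wedge,\vee,\to$ are ordinary operations making $A$ a Boolean algebra with bottom $0$ and top $1$ (with $\to$ the Boolean implication), and such that for all $a,b\in A$, $a\uparrow b=b\uparrow a$ (as sets), for all $a,b,c\in A$, if $c\in a\uparrow b$ then $a\wedge b\wedge c=0$, and for all $a\in A$, $\neg a\subseteq\{b\in A: a\vee b=1\}$; - $D=\{1\}$ (designated elements; $D$ is a proper subset of $A$, i.e. $0\ne1$); - $\mathcal F$ is the set of all valuations $\nu$ over $\mathcal A$ with $\nu(\alpha\uparrow\beta)=\nu(\beta\uparrow\alpha)$ for all formulas $\alpha,\beta$. $\Gamma\Vdash^{\mathbf{nbI}}_{\mathcal F}\varphi$ means: for every RNmatrix $(\mathcal A,D,\mathcal F)$ for $\mathbf{nbI}$ and every $\nu\in\mathcal F$, if $\nu(\gamma)\in D$ for all $\gamma\in\Gamma$ then $\nu(\varphi)\in D$. *)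

theory Defs
  imports Main "HOL-Library.Countable"
begin

datatype 'v fm =
    Var 'v
  | Disj "'v fm" "'v fm"  (infixr "\<^bold>\<or>" 65)
  | Conj "'v fm" "'v fm"  (infixr "\<^bold>\<and>" 70)
  | Imp "'v fm" "'v fm"  (infixr "\<^bold>\<rightarrow>" 60)
  | Up "'v fm" "'v fm"  (infixr "\<^bold>\<up>" 75)
  | Neg "'v fm"  ("\<^bold>\<not> _" [80] 80)

inductive_set nbI_axioms :: "'v fm set" where
  ax1: "\<alpha> \<^bold>\<rightarrow> (\<beta> \<^bold>\<rightarrow> \<alpha>) \<in> nbI_axioms"
| ax2: "(\<alpha> \<^bold>\<rightarrow> (\<beta> \<^bold>\<rightarrow> \<gamma>)) \<^bold>\<rightarrow> ((\<alpha> \<^bold>\<rightarrow> \<beta>) \<^bold>\<rightarrow> (\<alpha> \<^bold>\<rightarrow> \<gamma>)) \<in> nbI_axioms"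
| ax3: "\<alpha> \<^bold>\<rightarrow> (\<beta> \<^bold>\<rightarrow> (\<alpha> \<^bold>\<and> \<beta>)) \<in> nbI_axioms"
| ax4: "(\<alpha> \<^bold>\<and> \<beta>) \<^bold>\<rightarrow> \<alpha> \<in> nbI_axioms"
| ax5: "(\<alpha> \<^bold>\<and> \<beta>) \<^bold>\<rightarrow> \<beta> \<in> nbI_axioms"
| ax6: "\<alpha> \<^bold>\<rightarrow> (\<alpha> \<^bold>\<or> \<beta>) \<in> nbI_axioms"
| ax7: "\<beta> \<^bold>\<rightarrow> (\<alpha> \<^bold>\<or> \<beta>) \<in> nbI_axioms"
| ax8: "(\<alpha> \<^bold>\<rightarrow> \<gamma>) \<^bold>\<rightarrow> ((\<beta> \<^bold>\<rightarrow> \<gamma>) \<^bold>\<rightarrow> ((\<alpha> \<^bold>\<or> \<beta>) \<^bold>\<rightarrow> \<gamma>)) \<in> nbI_axioms"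
| ax9: "(\<alpha> \<^bold>\<rightarrow> \<beta>) \<^bold>\<or> \<alpha> \<in> nbI_axioms"
| axIp: "(\<alpha> \<^bold>\<up> \<beta>) \<^bold>\<rightarrow> (\<alpha> \<^bold>\<rightarrow> (\<beta> \<^bold>\<rightarrow> \<gamma>)) \<in> nbI_axioms"
| axComm: "(\<alpha> \<^bold>\<up> \<beta>) \<^bold>\<rightarrow> (\<beta> \<^bold>\<up> \<alpha>) \<in> nbI_axioms"
| ax11: "\<alpha> \<^bold>\<or> \<^bold>\<not> \<alpha> \<in> nbI_axioms"

definition nbI_derivation :: "'v fm set \<Rightarrow> 'v fm list \<Rightarrow> bool" where
  "nbI_derivation \<Gamma> ds \<longleftrightarrow>
     (\<forall>i < length ds. ds ! i \<in> \<Gamma> \<or> ds ! i \<in> nbI_axioms \<or>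
        (\<exists>j < i. \<exists>k < i. ds ! k = ds ! j \<^bold>\<rightarrow> ds ! i))"

definition nbI_derives :: "'v fm set \<Rightarrow> 'v fm \<Rightarrow> bool"  (infix "\<turnstile>\<^sub>n\<^sub>b\<^sub>I" 50) where
  "\<Gamma> \<turnstile>\<^sub>n\<^sub>b\<^sub>I \<phi> \<longleftrightarrow> (\<exists>ds. nbI_derivation \<Gamma> ds \<and> ds \<noteq> [] \<and> last ds = \<phi>)"

record 'a multialgebra =
  carrier :: "'a set"
  disj_op :: "'a \<Rightarrow> 'a \<Rightarrow> 'a set"
  conj_op :: "'a \<Rightarrow> 'a \<Rightarrow> 'a set"
  imp_op :: "'a \<Rightarrow> 'a \<Rightarrow> 'a set"
  up_op :: "'a \<Rightarrow> 'a \<Rightarrow> 'a set"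
  neg_op :: "'a \<Rightarrow> 'a set"

definition is_multialgebra :: "'a multialgebra \<Rightarrow> bool" where
  "is_multialgebra M \<longleftrightarrow>
     carrier M \<noteq> {} \<and>
     (\<forall>f \<in> {disj_op M, conj_op M, imp_op M, up_op M}.
        \<forall>a \<in> carrier M. \<forall>b \<in> carrier M. f a b \<in> Pow (carrier M) - {{}}) \<and>
     (\<forall>a \<in> carrier M. neg_op M a \<in> Pow (carrier M) - {{}})"

definition valuation :: "'a multialgebra \<Rightarrow> ('v fm \<Rightarrow> 'a) \<Rightarrow> bool" where
  "valuation M \<nu> \<longleftrightarrow>
     (\<forall>\<alpha>. \<nu> \<alpha> \<in> carrier M) \<and>
     (\<forall>\<alpha> \<beta>. \<nu> (\<alpha> \<^bold>\<or> \<beta>) \<in> disj_op M (\<nu> \<alpha>) (\<nu> \<beta>)) \<and>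
     (\<forall>\<alpha> \<beta>. \<nu> (\<alpha> \<^bold>\<and> \<beta>) \<in> conj_op M (\<nu> \<alpha>) (\<nu> \<beta>)) \<and>
     (\<forall>\<alpha> \<beta>. \<nu> (\<alpha> \<^bold>\<rightarrow> \<beta>) \<in> imp_op M (\<nu> \<alpha>) (\<nu> \<beta>)) \<and>
     (\<forall>\<alpha> \<beta>. \<nu> (\<alpha> \<^bold>\<up> \<beta>) \<in> up_op M (\<nu> \<alpha>) (\<nu> \<beta>)) \<and>
     (\<forall>\<alpha>. \<nu> (\<^bold>\<not> \<alpha>) \<in> neg_op M (\<nu> \<alpha>))"

text \<open>
  The axioms of \<open>abstract_boolean_algebra\<close>, relativised to a carrier set.
  One-element algebras are not excluded here.
\<close>

locale boolean_algebra_on =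
  fixes A :: "'a set"
    and meet join :: "'a \<Rightarrow> 'a \<Rightarrow> 'a"
    and compl :: "'a \<Rightarrow> 'a"
    and zero one :: 'a
  assumes meet_closed: "\<lbrakk>a \<in> A; b \<in> A\<rbrakk> \<Longrightarrow> meet a b \<in> A"
    and join_closed: "\<lbrakk>a \<in> A; b \<in> A\<rbrakk> \<Longrightarrow> join a b \<in> A"
    and compl_closed: "a \<in> A \<Longrightarrow> compl a \<in> A"
    and zero_closed: "zero \<in> A"
    and one_closed: "one \<in> A"
    and meet_assoc: "\<lbrakk>a \<in> A; b \<in> A; c \<in> A\<rbrakk> \<Longrightarrow> meet (meet a b) c = meet a (meet b c)"
    and join_assoc: "\<lbrakk>a \<in> A; b \<in> A; c \<in> A\<rbrakk> \<Longrightarrow> join (join a b) c = join a (join b c)"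
    and meet_comm: "\<lbrakk>a \<in> A; b \<in> A\<rbrakk> \<Longrightarrow> meet a b = meet b a"
    and join_comm: "\<lbrakk>a \<in> A; b \<in> A\<rbrakk> \<Longrightarrow> join a b = join b a"
    and meet_join_distrib:
      "\<lbrakk>a \<in> A; b \<in> A; c \<in> A\<rbrakk> \<Longrightarrow> meet a (join b c) = join (meet a b) (meet a c)"
    and join_meet_distrib:
      "\<lbrakk>a \<in> A; b \<in> A; c \<in> A\<rbrakk> \<Longrightarrow> join a (meet b c) = meet (join a b) (join a c)"
    and meet_one: "a \<in> A \<Longrightarrow> meet a one = a"
    and join_zero: "a \<in> A \<Longrightarrow> join a zero = a"
    and meet_compl: "a \<in> A \<Longrightarrow> meet a (compl a) = zero"
    and join_compl: "a \<in> A \<Longrightarrow> join a (compl a) = one"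

text \<open>
  The operations \<open>meet\<close>, \<open>join\<close>, \<open>imp\<close> are the ordinary operations with which the
  singleton-valued multioperations are identified. The complement is that of the Boolean
  algebra and is unrelated to the multioperation interpreting negation.
\<close>

definition nbI_RNmatrix ::
  "'a multialgebra \<times> 'a set \<times> ('v fm \<Rightarrow> 'a) set \<Rightarrow> bool" where
  "nbI_RNmatrix = (\<lambda>(M, D, F).
     is_multialgebra M \<and>
     (\<exists>meet join imp compl zero one.
        boolean_algebra_on (carrier M) meet join compl zero one \<and>
        (\<forall>a \<in> carrier M. \<forall>b \<in> carrier M.
           conj_op M a b = {meet a b} \<and>
           disj_op M a b = {join a b} \<and>
           imp_op M a b = {imp a b} \<and>
           imp a b = join (compl a) b) \<and>
        (\<forall>a \<in> carrier M. \<forall>b \<in> carrier M. up_op M a b = up_op M b a) \<and>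
        (\<forall>a \<in> carrier M. \<forall>b \<in> carrier M. \<forall>c \<in> carrier M.
           c \<in> up_op M a b \<longrightarrow> meet (meet a b) c = zero) \<and>
        (\<forall>a \<in> carrier M. neg_op M a \<subseteq> {b \<in> carrier M. join a b = one}) \<and>
        D = {one} \<and> zero \<noteq> one) \<and>
     F = {\<nu>. valuation M \<nu> \<and> (\<forall>\<alpha> \<beta>. \<nu> (\<alpha> \<^bold>\<up> \<beta>) = \<nu> (\<beta> \<^bold>\<up> \<alpha>))})"

text \<open>
  HOL cannot quantify over types inside a formula, so the type in which the universes of the
  RNmatrices live is a parameter; a theorem with \<open>'a\<close> free covers RNmatrices over every type.
\<close>

definition nbI_entails :: "'a itself \<Rightarrow> 'v fm set \<Rightarrow> 'v fm \<Rightarrow> bool" where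
  "nbI_entails _ \<Gamma> \<phi> \<longleftrightarrow>
     (\<forall>(M :: 'a multialgebra) D F. nbI_RNmatrix (M, D, F) \<longrightarrow>
        (\<forall>\<nu> \<in> F. (\<forall>\<gamma> \<in> \<Gamma>. \<nu> \<gamma> \<in> D) \<longrightarrow> \<nu> \<phi> \<in> D))"

end

theory Submission
  imports Defs
begin

text \<open>
  Soundness is proved by induction along a derivation. Only the value \<open>1\<close> is
  designated, so everything reduces to the order \<open>a \<le> b \<longleftrightarrow> a \<and> b = a\<close> of the Boolean algebra:
  \<open>a \<rightarrow> b\<close> has value \<open>1\<close> exactly when \<open>a \<le> b\<close> (\<open>imp_eq_one_iff\<close>), which at once
  makes Modus Ponens preserve designated values.

  Every axiom that is an implication can be attacked by residuation, \<open>x \<le> a \<rightarrow> b\<close> iff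
  \<open>x \<and> a \<le> b\<close> (\<open>le_imp_iff\<close>): it moves nested antecedents into one meet on the left and
  leaves an elementary inequality. The non-deterministic connectives need little: since a
  value of \<open>\<alpha> \<up> \<beta>\<close> meets \<open>\<nu> \<alpha> \<and> \<nu> \<beta>\<close> in \<open>0\<close>, the inequality left over from (Ip) has left side \<open>0\<close>;
  excluded middle is the condition on the values of negation; and (Comm) is an instance of
  \<open>a \<rightarrow> a\<close> precisely because restricted valuations give \<open>\<alpha> \<up> \<beta>\<close> and \<open>\<beta> \<up> \<alpha>\<close> the
  \<^emph>\<open>same\<close> value. Equality of the sets of admissible values would not
  suffice for that, as two different elements of the common set could be chosen.
\<close>

section \<open>Order and residuation in a Boolean algebra\<close>

context boolean_algebra_on
begin

definition le :: "'a \<Rightarrow> 'a \<Rightarrow> bool"  (infix "\<preceq>" 50) where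
  "a \<preceq> b \<longleftrightarrow> meet a b = a"

definition imp :: "'a \<Rightarrow> 'a \<Rightarrow> 'a" where
  "imp a b = join (compl a) b"

lemmas closed = meet_closed join_closed compl_closed zero_closed one_closed

lemma imp_closed: "a \<in> A \<Longrightarrow> b \<in> A \<Longrightarrow> imp a b \<in> A"
  by (simp add: imp_def closed)

lemma meet_idem:
  assumes "a \<in> A" shows "meet a a = a"
proof -
  have "a = meet a (join a (compl a))"
    using assms by (simp add: join_compl meet_one)
  also have "\<dots> = join (meet a a) (meet a (compl a))"
    using assms by (simp add: meet_join_distrib closed)
  also have "\<dots> = meet a a"
    using assms by (simp add: meet_compl join_zero closed)
  finally show ?thesis ..
qed

lemma meet_zero:
  assumes "a \<in> A" shows "meet a zero = zero"
proof -
  have "meet a zero = meet (meet a a) (compl a)"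
    using assms by (simp add: meet_compl meet_assoc closed)
  then show ?thesis using assms by (simp add: meet_idem meet_compl)
qed

lemma meet_join_absorb:
  assumes "a \<in> A" "b \<in> A" shows "meet a (join a b) = a"
proof -
  have "meet a (join a b) = meet (join a zero) (join a b)"
    using assms by (simp add: join_zero)
  also have "\<dots> = join a (meet zero b)"
    using assms by (simp add: join_meet_distrib closed)
  also have "\<dots> = a"
    using assms by (simp add: meet_comm[of zero] meet_zero join_zero closed)
  finally show ?thesis .
qed

lemma le_refl: "a \<in> A \<Longrightarrow> a \<preceq> a"
  by (simp add: le_def meet_idem)

lemma le_trans:
  assumes "a \<preceq> b" "b \<preceq> c" "a \<in> A" "b \<in> A" "c \<in> A" shows "a \<preceq> c"
  using assms unfolding le_def by (metis meet_assoc)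

lemma zero_le: "a \<in> A \<Longrightarrow> zero \<preceq> a"
  by (simp add: le_def meet_comm[of zero] meet_zero closed)

lemma one_le_iff: "a \<in> A \<Longrightarrow> one \<preceq> a \<longleftrightarrow> a = one"
  by (auto simp add: le_def meet_comm[of one] meet_one closed)

lemma meet_le2: "a \<in> A \<Longrightarrow> b \<in> A \<Longrightarrow> meet a b \<preceq> b"
  by (simp add: le_def meet_assoc meet_idem)

lemma meet_le1: "a \<in> A \<Longrightarrow> b \<in> A \<Longrightarrow> meet a b \<preceq> a"
  using meet_le2[of b a] by (simp add: meet_comm)

lemma le_join1: "a \<in> A \<Longrightarrow> b \<in> A \<Longrightarrow> a \<preceq> join a b"
  by (simp add: le_def meet_join_absorb)

lemma le_join2: "a \<in> A \<Longrightarrow> b \<in> A \<Longrightarrow> b \<preceq> join a b"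
  using le_join1[of b a] by (simp add: join_comm)

lemma le_meet:
  assumes "x \<preceq> a" "x \<preceq> b" "x \<in> A" "a \<in> A" "b \<in> A" shows "x \<preceq> meet a b"
  using assms unfolding le_def by (metis meet_assoc)

lemma join_le:
  assumes "a \<preceq> c" "b \<preceq> c" "a \<in> A" "b \<in> A" "c \<in> A" shows "join a b \<preceq> c"
proof -
  have "meet (join a b) c = join (meet c a) (meet c b)"
    using assms by (simp add: meet_comm[of _ c] meet_join_distrib closed)
  also have "\<dots> = join a b"
    using assms by (simp add: meet_comm[of c] le_def)
  finally show ?thesis by (simp add: le_def)
qed

lemma le_imp_iff:
  assumes "x \<in> A" "a \<in> A" "b \<in> A"
  shows "x \<preceq> imp a b \<longleftrightarrow> meet x a \<preceq> b"
proof
  assume L: "x \<preceq> imp a b"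
  have "meet x a \<preceq> meet a (imp a b)"
    using assms by (intro le_meet meet_le2 le_trans[OF meet_le1 L]) (simp_all add: closed imp_closed)
  also have "meet a (imp a b) = meet a b"
    using assms
    by (simp add: imp_def meet_join_distrib meet_compl join_comm[of zero] join_zero closed)
  finally show "meet x a \<preceq> b"
    using assms le_trans[OF _ meet_le2[of a b]] by (simp add: closed)
next
  assume R: "meet x a \<preceq> b"
  \<comment> \<open>Split \<open>x\<close> along \<open>a\<close>: the part outside \<open>a\<close> lies below the complement, the part inside below \<open>b\<close>.\<close>
  have "x = join (meet x (compl a)) (meet x a)"
    using assms
    by (simp add: meet_join_distrib[symmetric] join_comm[of _ a] join_compl meet_one closed)
  also have "\<dots> \<preceq> join (compl a) b"
    using assms
    by (intro join_le le_trans[OF meet_le2 le_join1] le_trans[OF R le_join2])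
      (simp_all add: closed)
  finally show "x \<preceq> imp a b" by (simp add: imp_def)
qed

lemma imp_eq_one_iff:
  assumes "a \<in> A" "b \<in> A" shows "imp a b = one \<longleftrightarrow> a \<preceq> b"
proof -
  have "imp a b = one \<longleftrightarrow> one \<preceq> imp a b"
    using assms by (simp add: one_le_iff imp_closed)
  also have "\<dots> \<longleftrightarrow> meet a one \<preceq> b"
    using assms by (simp add: le_imp_iff meet_comm closed)
  finally show ?thesis using assms by (simp add: meet_one)
qed

lemma le_mp:
  assumes "x \<preceq> imp a b" "x \<preceq> a" "x \<in> A" "a \<in> A" "b \<in> A" shows "x \<preceq> b"
  using assms by (simp add: le_imp_iff) (simp add: le_def)

lemma imp_self: "a \<in> A \<Longrightarrow> imp a a = one"
  by (simp add: imp_eq_one_iff le_refl)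

text \<open>
  By residuation it is enough that the meet of both antecedents with \<open>a\<close> lies below \<open>c\<close>;
  \<open>le_mp\<close> then replays the evident derivation of \<open>\<gamma>\<close> inside the order.
\<close>

lemma imp_distrib_valid:
  assumes "a \<in> A" "b \<in> A" "c \<in> A"
  shows "imp (imp a (imp b c)) (imp (imp a b) (imp a c)) = one"
proof -
  let ?p = "imp a (imp b c)" and ?q = "imp a b"
  let ?x = "meet (meet ?p ?q) a"
  have A: "?p \<in> A" "?q \<in> A" "meet ?p ?q \<in> A" "?x \<in> A" "imp b c \<in> A" "imp a c \<in> A"
    using assms by (simp_all add: closed imp_closed)
  have x: "?x \<preceq> meet ?p ?q" "?x \<preceq> a"
    using A assms by (simp_all add: meet_le1 meet_le2)
  have p: "?x \<preceq> ?p" by (rule le_trans[OF x(1) meet_le1]) (use A in auto)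
  have q: "?x \<preceq> ?q" by (rule le_trans[OF x(1) meet_le2]) (use A in auto)
  have "?x \<preceq> imp b c" by (rule le_mp[OF p x(2)]) (use A assms in auto)
  moreover have "?x \<preceq> b" by (rule le_mp[OF q x(2)]) (use A assms in auto)
  ultimately have "?x \<preceq> c" by (rule le_mp) (use A assms in auto)
  then show ?thesis using A assms by (simp add: imp_eq_one_iff le_imp_iff imp_closed)
qed

text \<open>
  By distributivity, the meet \<open>x\<close> of the first two antecedents satisfies
  \<open>x \<and> (a \<or> b) = (x \<and> a) \<or> (x \<and> b)\<close>, and both parts lie below \<open>c\<close>.
\<close>

lemma imp_cases_valid:
  assumes "a \<in> A" "b \<in> A" "c \<in> A"
  shows "imp (imp a c) (imp (imp b c) (imp (join a b) c)) = one"
proof -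
  let ?p = "imp a c" and ?q = "imp b c"
  let ?x = "meet ?p ?q"
  have A: "?p \<in> A" "?q \<in> A" "?x \<in> A" "join a b \<in> A" "imp (join a b) c \<in> A"
    using assms by (simp_all add: closed imp_closed)
  have "meet ?x a \<preceq> c" "meet ?x b \<preceq> c"
    using meet_le1[OF A(1,2)] meet_le2[OF A(1,2)] A assms by (simp_all add: le_imp_iff)
  then have "meet ?x (join a b) \<preceq> c"
    using A assms by (simp add: meet_join_distrib join_le closed)
  then show ?thesis using A assms by (simp add: imp_eq_one_iff le_imp_iff imp_closed)
qed

text \<open>
  Unlike the other laws of implication shown here, this one can fail in a Heyting algebra. It
  comes from \<open>a \<or> -a = 1\<close> for the complement of the algebra (not for the connective \<open>\<not>\<close>).
\<close>

lemma imp_join_self_valid: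
  assumes "a \<in> A" "b \<in> A"
  shows "join (imp a b) a = one"
proof -
  have "join (imp a b) a = join (join a (compl a)) b"
    using assms by (simp add: imp_def join_comm[of _ a] join_assoc closed)
  also have "\<dots> = join one b"
    using assms by (simp add: join_compl)
  also have "\<dots> = one"
    using assms le_join1[of one b] by (simp add: one_le_iff closed)
  finally show ?thesis .
qed

lemma imp_incompatible_valid:
  assumes "a \<in> A" "b \<in> A" "c \<in> A" "u \<in> A" and "meet (meet a b) u = zero"
  shows "imp u (imp a (imp b c)) = one"
proof -
  have "meet (meet u a) b = zero"
    using assms by (simp add: meet_assoc meet_comm[of u] closed)
  then show ?thesis
    using assms by (simp add: imp_eq_one_iff le_imp_iff zero_le closed imp_closed)
qed

section \<open>Soundness of the calculus\<close>

text \<open>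
  The hypotheses collect what membership in the restricted set of valuations of an RNmatrix
  says about the values of one valuation; the multioperations themselves are gone.
  Except in the cases singled out, residuation leaves an inequality that holds in every lattice.
\<close>

lemma nbI_axioms_valid:
  fixes \<nu> :: "'v fm \<Rightarrow> 'a"
  assumes in_A: "\<And>\<alpha>. \<nu> \<alpha> \<in> A"
    and disj: "\<And>\<alpha> \<beta>. \<nu> (\<alpha> \<^bold>\<or> \<beta>) = join (\<nu> \<alpha>) (\<nu> \<beta>)"
    and conj: "\<And>\<alpha> \<beta>. \<nu> (\<alpha> \<^bold>\<and> \<beta>) = meet (\<nu> \<alpha>) (\<nu> \<beta>)"
    and impl: "\<And>\<alpha> \<beta>. \<nu> (\<alpha> \<^bold>\<rightarrow> \<beta>) = imp (\<nu> \<alpha>) (\<nu> \<beta>)"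
    and up: "\<And>\<alpha> \<beta>. meet (meet (\<nu> \<alpha>) (\<nu> \<beta>)) (\<nu> (\<alpha> \<^bold>\<up> \<beta>)) = zero"
    and up_comm: "\<And>\<alpha> \<beta>. \<nu> (\<alpha> \<^bold>\<up> \<beta>) = \<nu> (\<beta> \<^bold>\<up> \<alpha>)"
    and neg: "\<And>\<alpha>. join (\<nu> \<alpha>) (\<nu> (\<^bold>\<not> \<alpha>)) = one"
    and "\<phi> \<in> nbI_axioms"
  shows "\<nu> \<phi> = one"
  using \<open>\<phi> \<in> nbI_axioms\<close>
proof cases
  case (ax2 \<alpha> \<beta> \<gamma>)
  then show ?thesis by (simp add: impl imp_distrib_valid in_A)
next
  case (ax8 \<alpha> \<gamma> \<beta>)
  then show ?thesis by (simp add: impl disj imp_cases_valid in_A)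
next
  case (ax9 \<alpha> \<beta>)
  then show ?thesis by (simp add: disj impl imp_join_self_valid in_A)
next
  case (axIp \<alpha> \<beta> \<gamma>)
  then show ?thesis by (simp add: impl imp_incompatible_valid in_A up)
next
  case (axComm \<alpha> \<beta>)
  then show ?thesis by (simp add: impl up_comm[of \<alpha> \<beta>] imp_self in_A)
next
  case (ax11 \<alpha>)
  then show ?thesis by (simp add: disj neg)
qed (simp_all add: disj conj impl in_A closed imp_closed imp_eq_one_iff le_imp_iff
    le_refl meet_le1 meet_le2 le_join1 le_join2)

end

lemma nbI_derivation_invariant:
  assumes "nbI_derivation \<Gamma> ds"
    and "\<And>\<gamma>. \<gamma> \<in> \<Gamma> \<Longrightarrow> P \<gamma>"
    and "\<And>\<alpha>. \<alpha> \<in> nbI_axioms \<Longrightarrow> P \<alpha>"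
    and "\<And>\<alpha> \<beta>. P (\<alpha> \<^bold>\<rightarrow> \<beta>) \<Longrightarrow> P \<alpha> \<Longrightarrow> P \<beta>"
    and "i < length ds"
  shows "P (ds ! i)"
  using \<open>i < length ds\<close>
proof (induction i rule: less_induct)
  case (less i)
  then consider "ds ! i \<in> \<Gamma>" | "ds ! i \<in> nbI_axioms"
    | j k where "j < i" "k < i" "ds ! k = ds ! j \<^bold>\<rightarrow> ds ! i"
    using assms(1) unfolding nbI_derivation_def by blast
  then show ?case
  proof cases
    case 3
    then have "P (ds ! j)" "P (ds ! j \<^bold>\<rightarrow> ds ! i)"
      using less.IH[of j] less.IH[of k] less.prems by auto
    then show ?thesis using assms(4) by blast
  qed (use assms in blast)+
qed

lemma nbI_derives_invariant:
  assumes "\<Gamma> \<turnstile>\<^sub>n\<^sub>b\<^sub>I \<phi>"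
    and "\<And>\<gamma>. \<gamma> \<in> \<Gamma> \<Longrightarrow> P \<gamma>"
    and "\<And>\<alpha>. \<alpha> \<in> nbI_axioms \<Longrightarrow> P \<alpha>"
    and "\<And>\<alpha> \<beta>. P (\<alpha> \<^bold>\<rightarrow> \<beta>) \<Longrightarrow> P \<alpha> \<Longrightarrow> P \<beta>"
  shows "P \<phi>"
proof -
  obtain ds where "nbI_derivation \<Gamma> ds" "ds \<noteq> []" "last ds = \<phi>"
    using assms(1) unfolding nbI_derives_def by blast
  then show ?thesis
    using nbI_derivation_invariant[of \<Gamma> ds P "length ds - 1"] assms(2-4)
    by (simp add: last_conv_nth)
qed

theorem theorem7:
  fixes \<Gamma> :: "('v :: countable) fm set" and \<phi> :: "'v fm"
  assumes "\<Gamma> \<turnstile>\<^sub>n\<^sub>b\<^sub>I \<phi>"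
  shows "nbI_entails TYPE('a) \<Gamma> \<phi>"
  unfolding nbI_entails_def
proof (intro allI impI ballI)
  fix M :: "'a multialgebra" and D F and \<nu> :: "'v fm \<Rightarrow> 'a"
  assume RN: "nbI_RNmatrix (M, D, F)" and "\<nu> \<in> F" and prem: "\<forall>\<gamma>\<in>\<Gamma>. \<nu> \<gamma> \<in> D"
  then have val: "valuation M \<nu>" and up_comm: "\<And>\<alpha> \<beta>. \<nu> (\<alpha> \<^bold>\<up> \<beta>) = \<nu> (\<beta> \<^bold>\<up> \<alpha>)"
    unfolding nbI_RNmatrix_def by auto
  obtain meet join imp compl zero one where
    BA: "boolean_algebra_on (carrier M) meet join compl zero one"
    and ops: "\<And>a b. a \<in> carrier M \<Longrightarrow> b \<in> carrier M \<Longrightarrow>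
      conj_op M a b = {meet a b} \<and> disj_op M a b = {join a b} \<and>
      imp_op M a b = {imp a b} \<and> imp a b = join (compl a) b"
    and up: "\<And>a b c. a \<in> carrier M \<Longrightarrow> b \<in> carrier M \<Longrightarrow> c \<in> carrier M \<Longrightarrow>
      c \<in> up_op M a b \<Longrightarrow> meet (meet a b) c = zero"
    and neg: "\<And>a. a \<in> carrier M \<Longrightarrow> neg_op M a \<subseteq> {b \<in> carrier M. join a b = one}"
    and D: "D = {one}"
    using RN unfolding nbI_RNmatrix_def prod.case by blast
  interpret B: boolean_algebra_on "carrier M" meet join compl zero one by (rule BA)
  have in_M: "\<And>\<alpha>. \<nu> \<alpha> \<in> carrier M"
    using val unfolding valuation_def by blast
  have impl: "\<nu> (\<alpha> \<^bold>\<rightarrow> \<beta>) = B.imp (\<nu> \<alpha>) (\<nu> \<beta>)" for \<alpha> \<beta>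
    using val ops[OF in_M in_M, of \<alpha> \<beta>] unfolding valuation_def B.imp_def by (metis singletonD)
  have "\<nu> \<phi> = one"
  proof (rule nbI_derives_invariant[OF assms, where P = "\<lambda>\<psi>. \<nu> \<psi> = one"])
    show "\<nu> \<gamma> = one" if "\<gamma> \<in> \<Gamma>" for \<gamma>
      using prem that D by blast
  next
    show "\<nu> \<alpha> = one" if "\<alpha> \<in> nbI_axioms" for \<alpha>
    proof (rule B.nbI_axioms_valid[OF in_M _ _ impl _ up_comm _ that])
      fix \<alpha> \<beta>
      show "\<nu> (\<alpha> \<^bold>\<or> \<beta>) = join (\<nu> \<alpha>) (\<nu> \<beta>)" "\<nu> (\<alpha> \<^bold>\<and> \<beta>) = meet (\<nu> \<alpha>) (\<nu> \<beta>)"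
        using val ops[OF in_M in_M, of \<alpha> \<beta>] unfolding valuation_def by (metis singletonD)+
      show "meet (meet (\<nu> \<alpha>) (\<nu> \<beta>)) (\<nu> (\<alpha> \<^bold>\<up> \<beta>)) = zero"
        using val up[OF in_M in_M in_M] unfolding valuation_def by blast
      show "join (\<nu> \<alpha>) (\<nu> (\<^bold>\<not> \<alpha>)) = one"
        using val neg[OF in_M, of \<alpha>] unfolding valuation_def by blast
    qed
  next
    fix \<alpha> \<beta> assume "\<nu> (\<alpha> \<^bold>\<rightarrow> \<beta>) = one" and "\<nu> \<alpha> = one"
    then show "\<nu> \<beta> = one"
      using in_M by (metis impl B.imp_eq_one_iff B.one_le_iff)
  qed
  then show "\<nu> \<phi> \<in> D" by (simp add: D)
qed

end
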